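(* Let $(V,\mu)$ be an infinite, connected, locally finite weighted graph, let $1\le p<\infty$, and let $q\in(1,\infty]$ be the Hölder conjugate exponent of $p$, i.e. $\frac1p+\frac1q=1$. Then the following three conditions are equivalent. (I) $(V,\mu)$ is $L^p$-parabolic. (II) $(V,\mu)$ admits the $L^q$-Liouville property, i.e. any superharmonic function $u\in L^q_+(V)$ must be zero. (III) Any non-negative solution $u:V\to[0,\infty)$ on $V$ of the system $$-\Delta u\ge 0,\qquad \Delta\big(|\Delta u|^{p-2}\Delta u\big)\ge 0$$ is harmonic, i.e. satisfies $\Delta u=0$ on $V$.
   Context: Weighted graph: $(V,E)$ is an infinite, connected, locally finite graph (loops allowed), and $\mu:V\times V\to[0,\infty)$, $\mu_{xy}=\mu_{yx}$, with $\mu_{xy}>0$ iff $x\sim y$. Vertex weight: $\mu(x)=\sum_{y\sim x}\mu_{xy}$. Random walk: $P(x,y)=\mu_{xy}/\mu(x)$, with $n$-step transition function $P_n(x,y)$, $P_0(x,y)=\mathbf 1_{\{x=y\}}$, and $p_n(x,y)=P_n(x,y)/\mu(y)$. The Laplacian is $\Delta u(x)=\frac1{\mu(x)}\sum_{y\sim x}\mu_{xy}(u(y)-u(x))$; $u$ is superharmonic if $-\Delta u\ge0$ on $V$. Green function: $g(x,y)=\sum_{n\ge0}p_n(x,y)\in(0,\infty]$. Green operator: for $f\ge0$, $Gf(x)=\sum_{y\in V}g(x,y)f(y)\mu(y)\in[0,\infty]$ (with $\infty\cdot0=0$). Norms: $\|f\|_{L^q(V)}=(\sum_{x\in V}|f(x)|^q\mu(x))^{1/q}$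 for $q<\infty$, and $\|f\|_{L^\infty(V)}=\sup_V|f|$. $L^q_+(V)$ is the set of non-negative functions $V\to\mathbb R$ with finite $L^q(V)$ norm. $L^p$-capacity of a finite set $K\subset V$: $$C_p(K)=\sup\Big\{\Big(\sum_{x\in K}f(x)\mu(x)\Big)^p:\ f\ge0\text{ a function supported in }K,\ \|Gf\|_{L^q(V)}\le1\Big\}.$$ $(V,\mu)$ is $L^p$-parabolic if $C_p(K)=0$ for every finite subset $K\subset V$. $(V,\mu)$ admits the $L^q$-Liouville property if any superharmonic function $u\in L^q_+(V)$ must be zero. In (III), given the first inequality, the second inequality is understood as $-\Delta(|\Delta u|^{p-1})\ge0$; for $p=1$ the system reduces to $-\Delta u\ge0$.
   Formalization: In (II), "must be zero" is replaced by "must be constant"; the "zero" version is claimed only when the constant 1 is not in L^q(V), since non-zero constants are superharmonic and refute (II) as written (e.g. Z with unit weights, p=1, where (I) and (III) hold). *)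

theory Defs
  imports "HOL-Analysis.Analysis"
begin

text \<open>
  The vertex set is the whole type \<open>'v\<close>. Since \<open>mu x y > 0\<close> holds exactly for adjacent
  vertices, the weight function determines the edges; loops are allowed.
\<close>

definition adj :: "('v \<Rightarrow> 'v \<Rightarrow> real) \<Rightarrow> 'v \<Rightarrow> 'v \<Rightarrow> bool" where
  "adj mu x y \<longleftrightarrow> 0 < mu x y"

locale weighted_graph =
  fixes mu :: "'v \<Rightarrow> 'v \<Rightarrow> real"
  assumes infinite_vertices: "infinite (UNIV :: 'v set)"
    and mu_nonneg: "0 \<le> mu x y"
    and mu_sym: "mu x y = mu y x"
    and locally_finite: "finite {y. adj mu x y}"
    and connected: "(adj mu)\<^sup>*\<^sup>* x y"

definition vweight :: "('v \<Rightarrow> 'v \<Rightarrow> real) \<Rightarrow> 'v \<Rightarrow> real" where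
  "vweight mu x = (\<Sum>y | adj mu x y. mu x y)"

definition trans_prob :: "('v \<Rightarrow> 'v \<Rightarrow> real) \<Rightarrow> 'v \<Rightarrow> 'v \<Rightarrow> real" where
  "trans_prob mu x y = mu x y / vweight mu x"

primrec trans_prob_n :: "('v \<Rightarrow> 'v \<Rightarrow> real) \<Rightarrow> nat \<Rightarrow> 'v \<Rightarrow> 'v \<Rightarrow> real" where
  "trans_prob_n mu 0 x y = (if x = y then 1 else 0)"
| "trans_prob_n mu (Suc n) x y = (\<Sum>z | adj mu x z. trans_prob mu x z * trans_prob_n mu n z y)"

definition heat_kernel :: "('v \<Rightarrow> 'v \<Rightarrow> real) \<Rightarrow> nat \<Rightarrow> 'v \<Rightarrow> 'v \<Rightarrow> real" where
  "heat_kernel mu n x y = trans_prob_n mu n x y / vweight mu y"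

definition laplacian :: "('v \<Rightarrow> 'v \<Rightarrow> real) \<Rightarrow> ('v \<Rightarrow> real) \<Rightarrow> 'v \<Rightarrow> real" where
  "laplacian mu u x = (1 / vweight mu x) * (\<Sum>y | adj mu x y. mu x y * (u y - u x))"

definition superharmonic :: "('v \<Rightarrow> 'v \<Rightarrow> real) \<Rightarrow> ('v \<Rightarrow> real) \<Rightarrow> bool" where
  "superharmonic mu u \<longleftrightarrow> (\<forall>x. - laplacian mu u x \<ge> 0)"

definition green :: "('v \<Rightarrow> 'v \<Rightarrow> real) \<Rightarrow> 'v \<Rightarrow> 'v \<Rightarrow> ennreal" where
  "green mu x y = (\<Sum>n. ennreal (heat_kernel mu n x y))"

text \<open>Only meant for \<open>f \<ge> 0\<close>; in \<^typ>\<open>ennreal\<close> we have \<open>\<infinity> * 0 = 0\<close>.\<close>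

definition green_op :: "('v \<Rightarrow> 'v \<Rightarrow> real) \<Rightarrow> ('v \<Rightarrow> real) \<Rightarrow> 'v \<Rightarrow> ennreal" where
  "green_op mu f x =
     (\<integral>\<^sup>+ y. green mu x y * ennreal (f y) * ennreal (vweight mu y) \<partial>count_space UNIV)"

text \<open>Powers of extended non-negative reals, for exponents \<open>r > 0\<close>.\<close>

definition ennreal_powr :: "ennreal \<Rightarrow> real \<Rightarrow> ennreal" where
  "ennreal_powr a r = (if a = \<infinity> then \<infinity> else ennreal (enn2real a powr r))"

text \<open>
  The norm takes an extended non-negative function, since \<open>G f\<close> may be infinite; for a real
  function \<open>f\<close> it is applied to \<open>\<bar>f\<bar>\<close>. The exponent \<open>q\<close> is positive, possibly infinite.
\<close>

definition Lq_norm :: "('v \<Rightarrow> 'v \<Rightarrow> real) \<Rightarrow> ennreal \<Rightarrow> ('v \<Rightarrow> ennreal) \<Rightarrow> ennreal" where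
  "Lq_norm mu q h =
     (if q = \<infinity> then (SUP x. h x)
      else ennreal_powr
             (\<integral>\<^sup>+ x. ennreal_powr (h x) (enn2real q) * ennreal (vweight mu x) \<partial>count_space UNIV)
             (1 / enn2real q))"

definition Lq_plus :: "('v \<Rightarrow> 'v \<Rightarrow> real) \<Rightarrow> ennreal \<Rightarrow> ('v \<Rightarrow> real) set" where
  "Lq_plus mu q = {u. (\<forall>x. 0 \<le> u x) \<and> Lq_norm mu q (\<lambda>x. ennreal \<bar>u x\<bar>) < \<infinity>}"

text \<open>In the next two definitions \<open>q\<close> stands for the Hoelder conjugate of \<open>p\<close>.\<close>

definition Lp_capacity :: "('v \<Rightarrow> 'v \<Rightarrow> real) \<Rightarrow> real \<Rightarrow> ennreal \<Rightarrow> 'v set \<Rightarrow> ennreal" where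
  "Lp_capacity mu p q K =
     Sup {ennreal ((\<Sum>x\<in>K. f x * vweight mu x) powr p) | f.
            (\<forall>x. 0 \<le> f x) \<and> (\<forall>x. x \<notin> K \<longrightarrow> f x = 0) \<and> Lq_norm mu q (green_op mu f) \<le> 1}"

definition Lp_parabolic :: "('v \<Rightarrow> 'v \<Rightarrow> real) \<Rightarrow> real \<Rightarrow> ennreal \<Rightarrow> bool" where
  "Lp_parabolic mu p q \<longleftrightarrow> (\<forall>K. finite K \<longrightarrow> Lp_capacity mu p q K = 0)"

definition Lq_Liouville :: "('v \<Rightarrow> 'v \<Rightarrow> real) \<Rightarrow> ennreal \<Rightarrow> bool" where
  "Lq_Liouville mu q \<longleftrightarrow> (\<forall>u \<in> Lq_plus mu q. superharmonic mu u \<longrightarrow> (\<forall>x. u x = 0))"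

text \<open>
  Constants are superharmonic, so the property above fails whenever a non-zero constant lies in
  \<open>L\<^sup>q\<close>: always for \<open>q = \<infinity>\<close>, and for \<open>q < \<infinity>\<close> exactly when the total vertex weight is finite.
  The following version does not have this defect, and is equivalent to \<^const>\<open>Lq_Liouville\<close>
  when no non-zero constant lies in \<open>L\<^sup>q\<close>.
\<close>

definition Lq_Liouville_const :: "('v \<Rightarrow> 'v \<Rightarrow> real) \<Rightarrow> ennreal \<Rightarrow> bool" where
  "Lq_Liouville_const mu q \<longleftrightarrow>
     (\<forall>u \<in> Lq_plus mu q. superharmonic mu u \<longrightarrow> (\<exists>c. \<forall>x. u x = c))"

lemma not_Lq_Liouville:
  assumes "(\<lambda>_. 1) \<in> Lq_plus mu q"
  shows "\<not> Lq_Liouville mu q"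
proof -
  have "superharmonic mu (\<lambda>_. 1)"
    by (simp add: superharmonic_def laplacian_def)
  with assms show ?thesis
    by (force simp: Lq_Liouville_def)
qed

lemma one_in_Linf: "(\<lambda>_. 1) \<in> Lq_plus mu \<infinity>"
  by (simp add: Lq_plus_def Lq_norm_def)

text \<open>
  The second inequality \<open>\<Delta>(\<bar>\<Delta>u\<bar>\<^bsup>p-2\<^esup> \<Delta>u) \<ge> 0\<close> of the system reads \<open>-\<Delta>(\<bar>\<Delta>u\<bar>\<^bsup>p-1\<^esup>) \<ge> 0\<close> because
  \<open>\<Delta>u \<le> 0\<close>. It is vacuous for \<open>p = 1\<close>, where \<open>\<bar>\<Delta>u\<bar>\<^sup>0\<close> is 1 by convention; the case is
  separated because \<open>0 powr 0 = 0\<close>.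
\<close>

definition solves_system :: "('v \<Rightarrow> 'v \<Rightarrow> real) \<Rightarrow> real \<Rightarrow> ('v \<Rightarrow> real) \<Rightarrow> bool" where
  "solves_system mu p u \<longleftrightarrow>
     superharmonic mu u \<and>
     (p \<noteq> 1 \<longrightarrow> superharmonic mu (\<lambda>x. \<bar>laplacian mu u x\<bar> powr (p - 1)))"

end

theory Submission
  imports Defs
begin

text \<open>
  All three conditions fail exactly when \<open>g = g(\<cdot>, y)\<close> lies in \<open>L\<^sup>q\<close> for some vertex \<open>y\<close>. For the
  capacity this is scaling. A non-constant superharmonic \<open>u \<ge> 0\<close> has a truncation \<open>min u c\<close> which is
  not harmonic at some \<open>y\<close>, and by \<open>G(-\<Delta>u) \<le> u\<close> the truncation dominates a positive multiple of \<open>g\<close>;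
  conversely \<open>g\<close> itself is superharmonic and non-constant. For \<open>p > 1\<close> the function \<open>G(g\<^bsup>q-1\<^esup>)\<close>, finite at
  \<open>y\<close> by symmetry of the Green function, solves the system; conversely, if \<open>u\<close> is a solution and
  \<open>v = \<bar>\<Delta>u\<bar>\<^bsup>p-1\<^esup>\<close> dominates a multiple of \<open>g\<close>, then \<open>u \<ge> G(v\<^bsup>q-1\<^esup>)\<close> bounds the \<open>L\<^sup>q\<close> norm of \<open>g\<close>.
\<close>

section \<open>Norms of extended non-negative functions\<close>

lemma ennreal_powr_mono:
  assumes "a \<le> b" "0 \<le> r"
  shows "ennreal_powr a r \<le> ennreal_powr b r"
proof (cases "b = \<infinity>")
  case False
  with assms have "a \<noteq> \<infinity>" by (auto simp: top_unique)
  with False assms show ?thesis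
    by (auto simp: ennreal_powr_def less_top intro!: ennreal_leI powr_mono2 enn2real_mono)
qed (simp add: ennreal_powr_def)

lemma ennreal_powr_cmult:
  assumes "0 < c"
  shows "ennreal_powr (ennreal c * a) r = ennreal (c powr r) * ennreal_powr a r"
  using assms
  by (cases a) (auto simp: ennreal_powr_def ennreal_mult_top powr_mult
      simp flip: ennreal_mult')

lemma ennreal_powr_finite_iff: "ennreal_powr a r < \<infinity> \<longleftrightarrow> a < \<infinity>"
  by (auto simp: ennreal_powr_def less_top)

lemma Lq_norm_mono:
  assumes "\<And>x. h x \<le> k x"
  shows "Lq_norm mu q h \<le> Lq_norm mu q k"
  using assms
  by (auto simp: Lq_norm_def intro!: ennreal_powr_mono nn_integral_mono mult_right_mono SUP_mono')

text \<open>Homogeneity converts a pointwise bound on a multiple of the Green function into a bound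
  on its norm.\<close>

lemma Lq_norm_cmult:
  assumes "0 < c" "0 < q"
  shows "Lq_norm mu q (\<lambda>x. ennreal c * h x) = ennreal c * Lq_norm mu q h"
proof (cases "q = \<infinity>")
  case True
  then show ?thesis
    by (simp add: Lq_norm_def SUP_mult_left_ennreal)
next
  case False
  with assms have r: "0 < enn2real q"
    by (simp add: enn2real_positive_iff less_top)
  have "(\<integral>\<^sup>+ x. ennreal_powr (ennreal c * h x) (enn2real q) * ennreal (vweight mu x) \<partial>count_space UNIV)
      = ennreal (c powr enn2real q) *
        (\<integral>\<^sup>+ x. ennreal_powr (h x) (enn2real q) * ennreal (vweight mu x) \<partial>count_space UNIV)"
    by (simp add: ennreal_powr_cmult[OF assms(1)] mult.assoc nn_integral_cmult)
  with False r assms show ?thesis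
    by (simp add: Lq_norm_def ennreal_powr_cmult powr_powr)
qed

lemma Lq_norm_real:
  assumes "0 \<le> r"
  shows "Lq_norm mu (ennreal r) h < \<infinity> \<longleftrightarrow>
    (\<integral>\<^sup>+ x. ennreal_powr (h x) r * ennreal (vweight mu x) \<partial>count_space UNIV) < \<infinity>"
  using assms by (simp add: Lq_norm_def ennreal_powr_finite_iff[unfolded infinity_ennreal_def])

lemma nn_integral_count_space_ge_point:
  "f x \<le> (\<integral>\<^sup>+ y. f y \<partial>count_space UNIV)"
proof -
  have "f x = (\<integral>\<^sup>+ y. f y * indicator {x} y \<partial>count_space UNIV)"
    by (simp add: nn_integral_count_space_indicator[symmetric] nn_integral_count_space_finite)
  also have "\<dots> \<le> (\<integral>\<^sup>+ y. f y \<partial>count_space UNIV)"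
    by (intro nn_integral_mono) (simp add: indicator_def)
  finally show ?thesis .
qed

text \<open>In \<open>ennreal\<close> the value \<open>q = 0\<close> gives
  \<open>1 / q = \<infinity>\<close> and is excluded, and \<open>q = \<infinity>\<close> forces
  \<open>p = 1\<close>. Every other pair has the explicit real form
  \<open>p / (p - 1)\<close>.\<close>

lemma conjugate_exponent_cases:
  assumes "1 \<le> p" "1 / ennreal p + 1 / q = 1"
  obtains "p = 1" "q = \<infinity>" | "1 < p" "q = ennreal (p / (p - 1))"
proof (cases "p = 1")
  case True
  \<comment> \<open>Both sides carry the finite summand 1, so it may be cancelled in
    \<open>ennreal\<close>.\<close>
  with assms(2) have "1 + 1 / q = 1 + 0" by (simp add: divide_ennreal_def)
  then have "1 / q = 0" by (simp only: ennreal_add_left_cancel) simp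
  then have "q = \<infinity>" by (simp add: divide_ennreal_def)
  with True that show ?thesis by blast
next
  case False
  with assms have p: "1 < p" by simp
  show ?thesis
  proof (cases q)
    case (real r)
    have "r \<noteq> 0" using real assms(2) by (auto simp: divide_ennreal_def)
    with real have r: "0 < r" by simp
    have "ennreal (1 / p + 1 / r) = 1"
      using assms(2) p r real divide_ennreal[of 1 p] divide_ennreal[of 1 r]
      by (subst ennreal_plus) auto
    then have "1 / p + 1 / r = 1"
      by (simp only: ennreal_eq_1)
    then have "r = p / (p - 1)" using p r by (simp add: field_simps)
    with real p that show ?thesis by blast
  next
    case top
    with assms(2) have "ennreal (1 / p) = 1" using p divide_ennreal[of 1 p]
      by simp
    then have "1 / p = 1" by (simp only: ennreal_eq_1)
    with p show ?thesis by simp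
  qed
qed

section \<open>Superharmonic functions\<close>

context weighted_graph
begin

text \<open>The graph is infinite, so there is a second vertex, and the first edge of a path to it
  has positive weight.\<close>

lemma vweight_pos: "0 < vweight mu x"
proof -
  obtain y where "y \<noteq> x"
    using infinite_vertices by (metis (full_types) ex_new_if_finite finite.emptyI finite_insert insertI1)
  with connected[of x y] obtain z where "adj mu x z"
    by (metis converse_rtranclpE)
  then show ?thesis
    unfolding vweight_def using locally_finite[of x]
    by (intro sum_pos2[of _ z]) (simp_all add: mu_nonneg, simp add: adj_def)
qed

lemma trans_prob_nonneg: "0 \<le> trans_prob mu x y"
  using vweight_pos[of x] by (simp add: trans_prob_def mu_nonneg)

lemma sum_trans_prob: "(\<Sum>y | adj mu x y. trans_prob mu x y) = 1"
  using vweight_pos[of x] by (simp add: trans_prob_def sum_divide_distrib[symmetric] vweight_def)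

lemma laplacian_eq: "laplacian mu u x = (\<Sum>y | adj mu x y. trans_prob mu x y * u y) - u x"
proof -
  have "laplacian mu u x = (\<Sum>y | adj mu x y. trans_prob mu x y * (u y - u x))"
    by (simp add: laplacian_def trans_prob_def sum_distrib_left)
  also have "\<dots> = (\<Sum>y | adj mu x y. trans_prob mu x y * u y) - (\<Sum>y | adj mu x y. trans_prob mu x y) * u x"
    by (simp add: right_diff_distrib sum_subtractf sum_distrib_right)
  finally show ?thesis by (simp add: sum_trans_prob)
qed

lemma nonharmonic_imp_nonconstant: "laplacian mu u a \<noteq> 0 \<Longrightarrow> \<nexists>c. \<forall>x. u x = c"
  by (force simp: laplacian_def)

lemma superharmonic_iff:
  "superharmonic mu u \<longleftrightarrow> (\<forall>x. (\<Sum>y | adj mu x y. trans_prob mu x y * u y) \<le> u x)"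
  by (simp add: superharmonic_def laplacian_eq)

text \<open>Averaging over neighbours is monotone and fixes constants, so the average of the minimum
  is below both \<open>u x\<close> and \<open>c\<close>.\<close>

lemma superharmonic_min_const:
  assumes "superharmonic mu u"
  shows "superharmonic mu (\<lambda>x. min (u x) c)"
  unfolding superharmonic_iff
proof
  fix x
  have "(\<Sum>y | adj mu x y. trans_prob mu x y * min (u y) c) \<le> (\<Sum>y | adj mu x y. trans_prob mu x y * u y)"
    by (intro sum_mono mult_left_mono) (auto simp: trans_prob_nonneg)
  also have "\<dots> \<le> u x" using assms by (simp add: superharmonic_iff)
  finally have 1: "(\<Sum>y | adj mu x y. trans_prob mu x y * min (u y) c) \<le> u x" .
  have "(\<Sum>y | adj mu x y. trans_prob mu x y * min (u y) c) \<le> (\<Sum>y | adj mu x y. trans_prob mu x y * c)"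
    by (intro sum_mono mult_left_mono) (auto simp: trans_prob_nonneg)
  also have "\<dots> = c" by (simp add: sum_trans_prob flip: sum_distrib_right)
  finally show "(\<Sum>y | adj mu x y. trans_prob mu x y * min (u y) c) \<le> min (u x) c"
    using 1 by simp
qed

text \<open>The maximum spreads along edges: where it is attained, harmonicity makes a sum of
  non-negative weighted differences vanish, so all neighbours attain it too. Connectedness does the
  rest.\<close>

lemma harmonic_max_principle:
  assumes harm: "\<And>x. laplacian mu w x = 0" and max: "\<And>x. w x \<le> w a"
  shows "w x = w a"
  using connected[of a x]
proof (induction rule: rtranclp_induct)
  case base
  show ?case by simp
next
  case (step y z)
  have "(\<Sum>z | adj mu y z. mu y z * (w a - w z)) = - (vweight mu y * laplacian mu w y)"
    using vweight_pos[of y] step.IH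
    by (simp add: laplacian_def sum_negf[symmetric] algebra_simps)
  also have "\<dots> = 0" by (simp add: harm)
  finally have "\<forall>z\<in>{z. adj mu y z}. mu y z * (w a - w z) = 0"
    using locally_finite[of y] max mu_nonneg
    by (subst (asm) sum_nonneg_eq_0_iff) auto
  with step.hyps(2) show ?case by (auto simp: adj_def)
qed

text \<open>If all truncations of \<open>u\<close> were harmonic, \<open>min u (u a)\<close> would attain its maximum at \<open>a\<close>, so
  every value of \<open>u\<close> would be its minimum.\<close>

lemma nonconstant_superharmonic_truncation:
  assumes "\<And>x. 0 \<le> u x" "\<nexists>c. \<forall>x. u x = c"
  obtains c y where "0 \<le> c" "laplacian mu (\<lambda>x. min (u x) c) y \<noteq> 0"
proof (rule ccontr)
  assume "\<not> thesis"
  with that have harm: "laplacian mu (\<lambda>x. min (u x) c) y = 0" if "0 \<le> c" for c y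
    using \<open>0 \<le> c\<close> by blast
  have "u a \<le> u x" for a x
    using harmonic_max_principle[of "\<lambda>x. min (u x) (u a)" a x] harm[OF assms(1)[of a]]
    by simp
  then have "u x = u a" for x a by (meson antisym)
  with assms(2) show False by blast
qed

section \<open>The Green function\<close>

lemma heat_kernel_0: "heat_kernel mu 0 x y = (if x = y then 1 / vweight mu y else 0)"
  by (simp add: heat_kernel_def)

lemma heat_kernel_Suc:
  "heat_kernel mu (Suc n) x y = (\<Sum>z | adj mu x z. trans_prob mu x z * heat_kernel mu n z y)"
  by (simp add: heat_kernel_def sum_divide_distrib)

lemma heat_kernel_nonneg: "0 \<le> heat_kernel mu n x y"
proof (induction n arbitrary: x)
  case 0
  then show ?case using vweight_pos[of y] by (simp add: heat_kernel_0)
next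
  case (Suc n)
  then show ?case by (simp add: heat_kernel_Suc sum_nonneg trans_prob_nonneg)
qed

text \<open>Both sides are \<open>heat_kernel mu (Suc n) x y\<close>: the left splits off the first
  step of the walk, the right the last step, reversed by symmetry of the weights. The recursion
  alone unfolds only the first argument, so symmetry of the kernel rests on this.\<close>

lemma heat_kernel_commute:
  "(\<Sum>z | adj mu x z. trans_prob mu x z * heat_kernel mu n z y) =
   (\<Sum>z | adj mu y z. trans_prob mu y z * heat_kernel mu n x z)"
proof (induction n arbitrary: x y)
  case 0
  have "(\<Sum>z | adj mu x z. trans_prob mu x z * heat_kernel mu 0 z y) = mu x y / (vweight mu x * vweight mu y)"
    for x y
  proof -
    have "(\<Sum>z | adj mu x z. trans_prob mu x z * heat_kernel mu 0 z y) =
        (\<Sum>z | adj mu x z. if z = y then trans_prob mu x y / vweight mu y else 0)"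
      by (intro sum.cong) (auto simp: heat_kernel_0)
    also have "\<dots> = mu x y / (vweight mu x * vweight mu y)"
      using locally_finite[of x] mu_nonneg[of x y]
      by (auto simp: trans_prob_def adj_def)
    finally show ?thesis .
  qed
  note 1 = this
  have "heat_kernel mu 0 x z = heat_kernel mu 0 z x" for z
    by (simp add: heat_kernel_0)
  then show ?case using 1[of x y] 1[of y x] by (simp add: mu_sym mult.commute)
next
  case (Suc n)
  have "(\<Sum>z | adj mu x z. trans_prob mu x z * heat_kernel mu (Suc n) z y) =
     (\<Sum>z | adj mu x z. \<Sum>w | adj mu y w. trans_prob mu x z * (trans_prob mu y w * heat_kernel mu n z w))"
    by (simp add: heat_kernel_Suc Suc.IH sum_distrib_left)
  also have "\<dots> = (\<Sum>w | adj mu y w. \<Sum>z | adj mu x z. trans_prob mu x z * (trans_prob mu y w * heat_kernel mu n z w))"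
    by (rule sum.swap)
  also have "\<dots> = (\<Sum>w | adj mu y w. trans_prob mu y w * heat_kernel mu (Suc n) x w)"
    by (simp add: heat_kernel_Suc sum_distrib_left mult.left_commute)
  finally show ?case .
qed

lemma heat_kernel_sym: "heat_kernel mu n x y = heat_kernel mu n y x"
proof (induction n arbitrary: x y)
  case (Suc n)
  show ?case
    unfolding heat_kernel_Suc[of _ x]
    by (subst heat_kernel_commute) (simp add: heat_kernel_Suc Suc.IH)
qed (simp add: heat_kernel_0)

lemma green_sym: "green mu x y = green mu y x"
  by (simp add: green_def heat_kernel_sym)

text \<open>For \<open>f \<ge> 0\<close> this is the n-th power of the transition operator applied
  to \<open>f\<close>, with values in \<open>ennreal\<close> so that summing over \<open>n\<close>
  needs no convergence hypothesis.\<close>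

definition heat_op :: "('v \<Rightarrow> real) \<Rightarrow> nat \<Rightarrow> 'v \<Rightarrow> ennreal" where
  "heat_op f n x =
     (\<integral>\<^sup>+ y. ennreal (heat_kernel mu n x y) * ennreal (f y) * ennreal (vweight mu y) \<partial>count_space UNIV)"

lemma green_op_suminf: "green_op mu f x = (\<Sum>n. heat_op f n x)"
  unfolding green_op_def heat_op_def green_def
  by (subst nn_integral_suminf[symmetric]) (auto simp: mult.assoc)

lemma heat_op_0: "heat_op f 0 x = ennreal (f x)"
proof -
  have "heat_op f 0 x = (\<integral>\<^sup>+ y. ennreal (f x) * indicator {x} y \<partial>count_space UNIV)"
    unfolding heat_op_def
  proof (intro nn_integral_cong)
    fix y
    have "ennreal (1 / vweight mu y) * ennreal (vweight mu y) = 1"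
      using vweight_pos[of y] by (simp flip: ennreal_mult'')
    then show "ennreal (heat_kernel mu 0 x y) * ennreal (f y) * ennreal (vweight mu y) =
        ennreal (f x) * indicator {x} y"
      by (auto simp: heat_kernel_0 mult.commute mult.left_commute indicator_def)
  qed
  also have "\<dots> = ennreal (f x)"
    by (simp add: nn_integral_cmult_indicator)
  finally show ?thesis .
qed

lemma heat_op_Suc:
  "heat_op f (Suc n) x = (\<Sum>z | adj mu x z. ennreal (trans_prob mu x z) * heat_op f n z)"
proof -
  have "ennreal (heat_kernel mu (Suc n) x y) =
      (\<Sum>z | adj mu x z. ennreal (trans_prob mu x z) * ennreal (heat_kernel mu n z y))" for y
    by (simp add: heat_kernel_Suc trans_prob_nonneg heat_kernel_nonneg flip: ennreal_mult' sum_ennreal)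
  then show ?thesis
    by (simp add: heat_op_def sum_distrib_right nn_integral_sum mult.assoc nn_integral_cmult)
qed

text \<open>The identity G = I + PG, obtained by splitting off the term \<open>n = 0\<close>. It
  holds in \<open>ennreal\<close> even where the potential is infinite.\<close>

lemma green_op_rec:
  "green_op mu f x = ennreal (f x) + (\<Sum>z | adj mu x z. ennreal (trans_prob mu x z) * green_op mu f z)"
proof -
  have "green_op mu f x = heat_op f 0 x + (\<Sum>n. heat_op f (Suc n) x)"
    unfolding green_op_suminf by (subst suminf_offset[where i=1]) auto
  also have "(\<Sum>n. heat_op f (Suc n) x) = (\<Sum>z | adj mu x z. ennreal (trans_prob mu x z) * green_op mu f z)"
    unfolding heat_op_Suc green_op_suminf
    by (subst suminf_sum) auto
  finally show ?thesis by (simp add: heat_op_0)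
qed

text \<open>With \<open>f = - \<Delta>u\<close> and P the transition operator, one has
  \<open>u = f + P u\<close>. The partial sums S of the potential satisfy the same recursion, the
  next one being \<open>f + P S\<close>, and start from 0, so they stay below
  \<open>u\<close>.\<close>

lemma green_op_le_superharmonic:
  assumes nonneg: "\<And>x. 0 \<le> u x" and sh: "superharmonic mu u"
  shows "green_op mu (\<lambda>x. - laplacian mu u x) x \<le> ennreal (u x)"
proof -
  let ?f = "\<lambda>x. - laplacian mu u x"
  have f: "0 \<le> ?f x" for x using sh by (simp add: superharmonic_def)
  have "(\<Sum>n<N. heat_op ?f n x) \<le> ennreal (u x)" for N
  proof (induction N arbitrary: x)
    case (Suc N)
    have "(\<Sum>n<Suc N. heat_op ?f n x) =
        ennreal (?f x) + (\<Sum>z | adj mu x z. ennreal (trans_prob mu x z) * (\<Sum>n<N. heat_op ?f n z))"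
      unfolding sum.lessThan_Suc_shift heat_op_0 heat_op_Suc
      by (subst sum.swap) (simp add: sum_distrib_left)
    also have "\<dots> \<le> ennreal (?f x) + (\<Sum>z | adj mu x z. ennreal (trans_prob mu x z) * ennreal (u z))"
      by (intro add_left_mono sum_mono mult_left_mono Suc.IH) auto
    also have "\<dots> = ennreal (?f x + (\<Sum>z | adj mu x z. trans_prob mu x z * u z))"
      using f[of x]
      by (subst ennreal_plus) (auto simp: trans_prob_nonneg nonneg sum_nonneg simp flip: ennreal_mult')
    also have "\<dots> = ennreal (u x)" by (simp add: laplacian_eq)
    finally show ?case .
  qed simp
  then show ?thesis
    unfolding green_op_suminf by (intro suminf_le_const) auto
qed

text \<open>Only the term at \<open>y\<close> of the potential of \<open>- \<Delta>u\<close> is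
  kept. Hence a superharmonic function that is not harmonic at \<open>y\<close> dominates a positive
  multiple of the Green function with pole \<open>y\<close>.\<close>

lemma green_le_superharmonic:
  assumes "\<And>x. 0 \<le> u x" "superharmonic mu u"
  shows "ennreal (- laplacian mu u y * vweight mu y) * green mu x y \<le> ennreal (u x)"
proof -
  have "0 \<le> - laplacian mu u y" using assms(2) by (simp add: superharmonic_def)
  then have "ennreal (- laplacian mu u y * vweight mu y) * green mu x y =
      green mu x y * ennreal (- laplacian mu u y) * ennreal (vweight mu y)"
    using vweight_pos[of y] by (simp only: ennreal_mult'' less_imp_le ac_simps)
  also have "\<dots> \<le> green_op mu (\<lambda>x. - laplacian mu u x) x"
    unfolding green_op_def by (rule nn_integral_count_space_ge_point)
  also have "\<dots> \<le> ennreal (u x)" using assms by (rule green_op_le_superharmonic)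
  finally show ?thesis .
qed

text \<open>By the recursion, \<open>green_op mu f y\<close> bounds a positive multiple of the value
  at each neighbour of \<open>y\<close>, so finiteness travels along paths.\<close>

lemma green_op_finite:
  assumes "green_op mu f a < \<infinity>"
  shows "green_op mu f x < \<infinity>"
  using connected[of a x]
proof (induction rule: rtranclp_induct)
  case base
  show ?case by fact
next
  case (step y z)
  have "ennreal (trans_prob mu y z) * green_op mu f z \<le>
      (\<Sum>z | adj mu y z. ennreal (trans_prob mu y z) * green_op mu f z)"
    using step.hyps(2) locally_finite[of y]
    by (intro member_le_sum) auto
  also have "\<dots> \<le> green_op mu f y" by (subst (2) green_op_rec) simp
  finally have "ennreal (trans_prob mu y z) * green_op mu f z < \<infinity>"
    using step.IH by (rule le_less_trans)
  moreover have "0 < trans_prob mu y z"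
    using step.hyps(2) vweight_pos[of y] by (simp add: trans_prob_def adj_def)
  ultimately show ?case by (auto simp: ennreal_mult_less_top)
qed

lemma laplacian_green_op:
  assumes "\<And>x. 0 \<le> f x" "\<And>x. green_op mu f x < \<infinity>"
  shows "laplacian mu (\<lambda>x. enn2real (green_op mu f x)) x = - f x"
proof -
  define u where "u = (\<lambda>x. enn2real (green_op mu f x))"
  have u: "green_op mu f x = ennreal (u x)" "0 \<le> u x" for x
    using assms(2)[of x] by (simp_all add: u_def)
  have "ennreal (u x) = ennreal (f x + (\<Sum>z | adj mu x z. trans_prob mu x z * u z))"
    using green_op_rec[of f x] assms(1)[of x]
    by (simp add: u trans_prob_nonneg ennreal_plus sum_nonneg flip: ennreal_mult')
  then have "u x = f x + (\<Sum>z | adj mu x z. trans_prob mu x z * u z)"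
    by (subst (asm) ennreal_inj) (auto simp: u assms(1) trans_prob_nonneg intro!: sum_nonneg add_nonneg_nonneg)
  then show ?thesis by (simp add: laplacian_eq flip: u_def)
qed

section \<open>The Green function as the potential of a point mass\<close>

lemma green_op_point:
  assumes "0 \<le> c"
  shows "green_op mu (\<lambda>z. if z = y then c else 0) x = ennreal (c * vweight mu y) * green mu x y"
proof -
  have "green_op mu (\<lambda>z. if z = y then c else 0) x =
      (\<integral>\<^sup>+ z. ennreal (c * vweight mu y) * green mu x y * indicator {y} z \<partial>count_space UNIV)"
    unfolding green_op_def using assms vweight_pos[of y]
    by (intro nn_integral_cong) (auto simp: indicator_def ennreal_mult' ac_simps)
  then show ?thesis by (simp add: nn_integral_cmult_indicator)
qed

lemma green_eq_green_op: "green mu x y = green_op mu (\<lambda>z. if z = y then 1 / vweight mu y else 0) x"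
  using vweight_pos[of y] by (subst green_op_point) auto

lemma laplacian_green:
  assumes "\<And>x. green mu x y < \<infinity>"
  shows "laplacian mu (\<lambda>x. enn2real (green mu x y)) x = - (if x = y then 1 / vweight mu y else 0)"
  using assms vweight_pos[of y] unfolding green_eq_green_op by (subst laplacian_green_op) auto

lemma superharmonic_green:
  assumes "\<And>x. green mu x y < \<infinity>"
  shows "superharmonic mu (\<lambda>x. enn2real (green mu x y))"
  using vweight_pos[of y] by (simp add: superharmonic_def laplacian_green[OF assms])

text \<open>Vertex weights are positive, so an infinite value at one vertex already makes the norm
  infinite. This permits passing from \<open>green\<close> to a real-valued function.\<close>

lemma Lq_norm_finite_imp_finite:
  assumes "Lq_norm mu q h < \<infinity>"
  shows "h x < \<infinity>"
proof (cases "q = \<infinity>")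
  case True
  then show ?thesis
    using assms by (auto simp: Lq_norm_def intro: le_less_trans[OF SUP_upper])
next
  case False
  with assms have "(\<integral>\<^sup>+ x. ennreal_powr (h x) (enn2real q) * ennreal (vweight mu x) \<partial>count_space UNIV) < \<infinity>"
    by (simp add: Lq_norm_def ennreal_powr_finite_iff[unfolded infinity_ennreal_def])
  then have "ennreal_powr (h x) (enn2real q) * ennreal (vweight mu x) < \<infinity>"
    by (rule le_less_trans[OF nn_integral_count_space_ge_point])
  then show ?thesis
    using vweight_pos[of x] ennreal_powr_finite_iff[of "h x" "enn2real q"]
    by (auto simp: ennreal_mult_less_top)
qed

section \<open>Parabolicity\<close>

text \<open>The potential of a point mass at \<open>y\<close> is a multiple of the Green function
  with pole \<open>y\<close>; if that has finite norm, a small point mass is admissible for the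
  capacity. Conversely, an admissible \<open>f\<close> with \<open>f y > 0\<close> has a potential
  above such a multiple, which is impossible if the norm is infinite.\<close>

lemma Lp_parabolic_iff_green:
  assumes "0 < q"
  shows "Lp_parabolic mu p q \<longleftrightarrow> (\<forall>y. Lq_norm mu q (\<lambda>x. green mu x y) = \<infinity>)"
proof
  assume par: "Lp_parabolic mu p q"
  show "\<forall>y. Lq_norm mu q (\<lambda>x. green mu x y) = \<infinity>"
  proof (intro allI, rule ccontr)
    fix y
    assume "Lq_norm mu q (\<lambda>x. green mu x y) \<noteq> \<infinity>"
    then obtain N where N: "Lq_norm mu q (\<lambda>x. green mu x y) = ennreal N" "0 \<le> N"
      by (cases "Lq_norm mu q (\<lambda>x. green mu x y)") auto
    \<comment> \<open>The shift by 1 keeps the denominator positive without a lower bound on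
      \<open>N\<close>; the potential then has norm \<open>N / (N + 1)\<close>.\<close>
    define c where "c = 1 / ((N + 1) * vweight mu y)"
    define f where "f = (\<lambda>z. if z = y then c else 0)"
    have c: "0 < c" "c * vweight mu y = 1 / (N + 1)"
      using N vweight_pos[of y] by (auto simp: c_def)
    have "green_op mu f = (\<lambda>x. ennreal (1 / (N + 1)) * green mu x y)"
      using c by (auto simp: f_def green_op_point)
    then have "Lq_norm mu q (green_op mu f) = ennreal (1 / (N + 1)) * ennreal N"
      using N assms by (simp add: Lq_norm_cmult)
    also have "\<dots> \<le> 1"
      using N by (simp flip: ennreal_mult')
    finally have "ennreal ((\<Sum>x\<in>{y}. f x * vweight mu x) powr p) \<le> Lp_capacity mu p q {y}"
      unfolding Lp_capacity_def using c
      by (intro Sup_upper CollectI exI[of _ f]) (auto simp: f_def)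
    moreover have "Lp_capacity mu p q {y} = 0"
      using par by (simp add: Lp_parabolic_def)
    moreover have "0 < (\<Sum>x\<in>{y}. f x * vweight mu x) powr p"
      using N by (simp add: f_def c)
    ultimately show False by (simp add: ennreal_eq_0_iff)
  qed
next
  assume inf: "\<forall>y. Lq_norm mu q (\<lambda>x. green mu x y) = \<infinity>"
  have zero: "f y = 0" if f: "\<And>x. 0 \<le> f x" "Lq_norm mu q (green_op mu f) \<le> 1" for f y
  proof (rule ccontr)
    assume "f y \<noteq> 0"
    with f(1)[of y] have pos: "0 < f y * vweight mu y" using vweight_pos[of y] by simp
    have "ennreal (f y * vweight mu y) * green mu x y \<le> green_op mu f x" for x
      unfolding green_op_def
      using f(1)[of y] nn_integral_count_space_ge_point[of "\<lambda>y. green mu x y * ennreal (f y) * ennreal (vweight mu y)" y]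
      by (simp add: ennreal_mult' ac_simps)
    then have "ennreal (f y * vweight mu y) * Lq_norm mu q (\<lambda>x. green mu x y) \<le> 1"
      using Lq_norm_mono[of "\<lambda>x. ennreal (f y * vweight mu y) * green mu x y" "green_op mu f" mu q] f(2)
      by (simp add: Lq_norm_cmult[OF pos assms])
    moreover have "ennreal (f y * vweight mu y) * Lq_norm mu q (\<lambda>x. green mu x y) = \<infinity>"
      using inf pos by (auto simp: ennreal_mult_top)
    ultimately show False by (simp add: top_unique)
  qed
  have "Lp_capacity mu p q K \<le> 0" for K
    unfolding Lp_capacity_def
  proof (rule Sup_least, clarify)
    fix f :: "'v \<Rightarrow> real"
    assume "\<forall>x. 0 \<le> f x" "Lq_norm mu q (green_op mu f) \<le> 1"
    then have "f x = 0" for x using zero[of f x] by blast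
    then show "ennreal ((\<Sum>x\<in>K. f x * vweight mu x) powr p) \<le> 0" by simp
  qed
  then show "Lp_parabolic mu p q" by (simp add: Lp_parabolic_def)
qed

section \<open>The Liouville property\<close>

lemma Lq_norm_green_finite:
  assumes "0 < q" "\<And>x. 0 \<le> u x" "superharmonic mu u" "laplacian mu u y \<noteq> 0"
    and fin: "Lq_norm mu q (\<lambda>x. ennreal (u x)) < \<infinity>"
  shows "Lq_norm mu q (\<lambda>x. green mu x y) < \<infinity>"
proof -
  let ?c = "- laplacian mu u y * vweight mu y"
  have "0 < - laplacian mu u y" using assms(3)[unfolded superharmonic_def, rule_format, of y] assms(4) by simp
  then have c: "0 < ?c"
    using vweight_pos[of y] by (rule mult_pos_pos)
  have "ennreal ?c * Lq_norm mu q (\<lambda>x. green mu x y) = Lq_norm mu q (\<lambda>x. ennreal ?c * green mu x y)"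
    by (rule Lq_norm_cmult[symmetric]) (use c assms(1) in auto)
  also have "\<dots> \<le> Lq_norm mu q (\<lambda>x. ennreal (u x))"
    by (intro Lq_norm_mono green_le_superharmonic assms)
  finally have "ennreal ?c * Lq_norm mu q (\<lambda>x. green mu x y) < \<infinity>" using fin by (rule le_less_trans)
  with c show ?thesis by (auto simp: ennreal_mult_less_top ennreal_eq_0_iff)
qed

lemma Lp_parabolic_iff_Liouville_const:
  assumes "0 < q"
  shows "Lp_parabolic mu p q \<longleftrightarrow> Lq_Liouville_const mu q"
proof
  assume par: "Lp_parabolic mu p q"
  show "Lq_Liouville_const mu q"
    unfolding Lq_Liouville_const_def
  proof (intro ballI impI, rule ccontr)
    fix u
    assume "u \<in> Lq_plus mu q" and sh: "superharmonic mu u" and nc: "\<nexists>c. \<forall>x. u x = c"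
    then have u: "\<And>x. 0 \<le> u x" "Lq_norm mu q (\<lambda>x. ennreal (u x)) < \<infinity>"
      by (auto simp: Lq_plus_def)
    \<comment> \<open>The function \<open>u\<close> may itself be harmonic; only a truncation is
      certain to have a vertex with non-zero Laplacian.\<close>
    from u(1) nc obtain c y where c: "0 \<le> c" "laplacian mu (\<lambda>x. min (u x) c) y \<noteq> 0"
      by (rule nonconstant_superharmonic_truncation)
    have "Lq_norm mu q (\<lambda>x. ennreal (min (u x) c)) < \<infinity>"
      using u(2) by (rule le_less_trans[OF Lq_norm_mono, rotated]) (simp add: ennreal_leI)
    then have "Lq_norm mu q (\<lambda>x. green mu x y) < \<infinity>"
      using c u(1) by (intro Lq_norm_green_finite[OF assms _ superharmonic_min_const[OF sh]]) auto
    with par show False by (simp add: Lp_parabolic_iff_green[OF assms])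
  qed
next
  assume liou: "Lq_Liouville_const mu q"
  show "Lp_parabolic mu p q"
  proof (rule ccontr)
    assume "\<not> Lp_parabolic mu p q"
    then obtain y where y: "Lq_norm mu q (\<lambda>x. green mu x y) < \<infinity>"
      by (auto simp: Lp_parabolic_iff_green[OF assms] less_top)
    have fin: "green mu x y < \<infinity>" for x using Lq_norm_finite_imp_finite[OF y] .
    let ?u = "\<lambda>x. enn2real (green mu x y)"
    have "?u \<in> Lq_plus mu q" using y fin by (simp add: Lq_plus_def)
    then obtain c where "\<forall>x. ?u x = c"
      using liou superharmonic_green[OF fin] unfolding Lq_Liouville_const_def by blast
    then have "laplacian mu ?u y = 0" by (simp add: laplacian_def)
    then show False using vweight_pos[of y] by (simp add: laplacian_green[OF fin])
  qed
qed

text \<open>A positive constant function with finite norm could be rescaled to the constant 1, so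
  the only constant left is 0.\<close>

lemma Liouville_const_iff_Liouville:
  assumes "0 < q" "(\<lambda>_. 1) \<notin> Lq_plus mu q"
  shows "Lq_Liouville_const mu q \<longleftrightarrow> Lq_Liouville mu q"
proof
  assume liou: "Lq_Liouville_const mu q"
  show "Lq_Liouville mu q"
    unfolding Lq_Liouville_def
  proof (intro ballI impI, rule ccontr)
    fix u
    assume u: "u \<in> Lq_plus mu q" "superharmonic mu u" and ne: "\<not> (\<forall>x. u x = 0)"
    with liou obtain c where c: "\<And>x. u x = c" unfolding Lq_Liouville_const_def by blast
    with ne u(1) have "0 < c" by (auto simp: Lq_plus_def less_le)
    have "Lq_norm mu q (\<lambda>x. ennreal c * 1) < \<infinity>" using u(1) c \<open>0 < c\<close> by (simp add: Lq_plus_def)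
    then have "Lq_norm mu q (\<lambda>_. 1) < \<infinity>"
      using \<open>0 < c\<close> unfolding Lq_norm_cmult[OF \<open>0 < c\<close> assms(1)]
      by (auto simp: ennreal_mult_less_top)
    with assms(2) show False by (simp add: Lq_plus_def)
  qed
qed (auto simp: Lq_Liouville_const_def Lq_Liouville_def)

section \<open>The system of inequalities\<close>

text \<open>Here \<open>\<integral> g\<^bsup>q\<^esup> d\<mu> \<le> C' \<integral> g f d\<mu> = C' G f(y)\<close>, because \<open>g\<^bsup>q-1\<^esup> \<le> C' f\<close>.\<close>

lemma green_Lq_of_green_op_finite:
  assumes p: "1 < p" and f: "\<And>x. 0 \<le> f x" and fin: "green_op mu f y < \<infinity>" and "0 \<le> C"
    and le: "\<And>x. green mu x y \<le> ennreal (C * f x powr (p - 1))"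
  shows "Lq_norm mu (ennreal (p / (p - 1))) (\<lambda>x. green mu x y) < \<infinity>"
proof -
  define r where "r = p / (p - 1)"
  have r: "1 < r" "(p - 1) * (r - 1) = 1" using p by (auto simp: r_def field_simps)
  \<comment> \<open>The exponent \<open>r - 1\<close> is inverse to \<open>p - 1\<close>, so raising
    \<open>le\<close> to it gives a bound linear in \<open>f\<close>, with \<open>C'\<close> in
    place of \<open>C\<close>.\<close>
  define C' where "C' = C powr (r - 1)"
  \<comment> \<open>On the right the arguments of the Green function are swapped, so that summing
    over \<open>x\<close> produces \<open>green_op mu f y\<close>.\<close>
  have "ennreal_powr (green mu x y) r * ennreal (vweight mu x)
      \<le> ennreal C' * (green mu y x * ennreal (f x) * ennreal (vweight mu x))" for x
  proof -
    obtain g where g: "green mu x y = ennreal g" "0 \<le> g"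
      using le[of x] by (cases "green mu x y") (auto simp: top_unique)
    have "g \<le> C * f x powr (p - 1)" using le[of x] g \<open>0 \<le> C\<close> by simp
    then have "g powr (r - 1) \<le> (C * f x powr (p - 1)) powr (r - 1)"
      using r g by (intro powr_mono2) auto
    also have "\<dots> = C' * f x" using r f[of x] \<open>0 \<le> C\<close> by (simp add: powr_mult powr_powr C'_def)
    finally have "g * g powr (r - 1) \<le> g * (C' * f x)"
      using g(2) by (rule mult_left_mono)
    then have "g powr r \<le> C' * (g * f x)" using g by (simp add: powr_mult_base mult.left_commute)
    then have "ennreal (g powr r * vweight mu x) \<le> ennreal (C' * (g * f x) * vweight mu x)"
      using vweight_pos[of x] by (intro ennreal_leI mult_right_mono) auto
    then show ?thesis
      using g f[of x] vweight_pos[of x]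
      by (simp add: green_sym[of y x] ennreal_powr_def ennreal_mult' ennreal_mult'' C'_def ac_simps)
  qed
  then have "(\<integral>\<^sup>+ x. ennreal_powr (green mu x y) r * ennreal (vweight mu x) \<partial>count_space UNIV)
      \<le> (\<integral>\<^sup>+ x. ennreal C' * (green mu y x * ennreal (f x) * ennreal (vweight mu x)) \<partial>count_space UNIV)"
    by (rule nn_integral_mono)
  also have "\<dots> = ennreal C' * green_op mu f y"
    by (simp add: nn_integral_cmult green_op_def)
  also have "\<dots> < \<infinity>" using fin by (simp add: ennreal_mult_less_top)
  finally show ?thesis using r by (simp only: Lq_norm_real r_def[symmetric])
qed

lemma solves_system_iff:
  assumes "p \<noteq> 1"
  shows "solves_system mu p u \<longleftrightarrow> superharmonic mu u \<and> superharmonic mu (\<lambda>x. (- laplacian mu u x) powr (p - 1))"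
proof -
  have "(\<lambda>x. \<bar>laplacian mu u x\<bar> powr (p - 1)) = (\<lambda>x. (- laplacian mu u x) powr (p - 1))"
    if "superharmonic mu u"
    using that by (auto simp: superharmonic_def abs_of_nonpos)
  then show ?thesis using assms by (auto simp: solves_system_def)
qed

text \<open>The second inequality makes \<open>v\<close> superharmonic, and the first bounds the
  potential of \<open>f\<close> by \<open>u\<close>. Once a multiple of \<open>v\<close> dominates
  the Green function with some pole \<open>y\<close>, the preceding estimate applies;
  \<open>y\<close> may differ from \<open>a\<close>.\<close>

lemma green_Lq_of_nonharmonic_solution:
  assumes p: "1 < p" and u: "\<And>x. 0 \<le> u x" and sol: "solves_system mu p u"
    and nh: "laplacian mu u a \<noteq> 0"
  shows "\<exists>y. Lq_norm mu (ennreal (p / (p - 1))) (\<lambda>x. green mu x y) < \<infinity>"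
proof -
  define f where "f = (\<lambda>x. - laplacian mu u x)"
  define v where "v = (\<lambda>x. f x powr (p - 1))"
  have sh: "superharmonic mu u" "superharmonic mu v"
    using sol p by (auto simp: solves_system_iff v_def f_def)
  have f: "0 \<le> f x" for x using sh(1) by (simp add: superharmonic_def f_def)
  have fa: "0 < f a" using f[of a] nh by (simp add: f_def less_le)
  have Gf: "green_op mu f x < \<infinity>" for x
    using green_op_le_superharmonic[OF u sh(1), of x] by (auto simp: f_def intro: le_less_trans)
  text \<open>It suffices to dominate a multiple of \<open>v\<close> by a superharmonic function that is not harmonic;
    for constant \<open>v\<close> truncations of \<open>u\<close> serve.\<close>
  have "\<exists>w D y. superharmonic mu w \<and> (\<forall>x. 0 \<le> w x) \<and> 0 \<le> D \<and> (\<forall>x. w x \<le> D * v x) \<and> laplacian mu w y \<noteq> 0"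
  proof (cases "\<exists>k. \<forall>x. v x = k")
    case False
    have "0 \<le> v x" for x by (simp add: v_def)
    then obtain c y where "0 \<le> c" "laplacian mu (\<lambda>x. min (v x) c) y \<noteq> 0"
      using False by (rule nonconstant_superharmonic_truncation)
    then show ?thesis
      by (intro exI[of _ "\<lambda>x. min (v x) c"] exI[of _ 1] exI[of _ y])
        (auto simp: superharmonic_min_const sh \<open>\<And>x. 0 \<le> v x\<close>)
  next
    case True
    then have v: "v x = v a" for x by metis
    have va: "0 < v a" using fa by (simp add: v_def)
    have "\<nexists>c. \<forall>x. u x = c" using nh by (rule nonharmonic_imp_nonconstant)
    with u obtain c y where c: "0 \<le> c" "laplacian mu (\<lambda>x. min (u x) c) y \<noteq> 0"
      by (rule nonconstant_superharmonic_truncation)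
    \<comment> \<open>Since \<open>v\<close> is constantly \<open>v a > 0\<close>, the right-hand
      side is just \<open>c\<close>.\<close>
    have "min (u x) c \<le> c / v a * v x" for x using va v[of x] by simp
    with c va show ?thesis
      by (intro exI[of _ "\<lambda>x. min (u x) c"] exI[of _ "c / v a"] exI[of _ y])
        (auto simp: superharmonic_min_const sh u)
  qed
  then obtain w D y where w: "superharmonic mu w" "\<And>x. 0 \<le> w x" "0 \<le> D" "\<And>x. w x \<le> D * v x"
      "laplacian mu w y \<noteq> 0" by blast
  define c where "c = - laplacian mu w y * vweight mu y"
  have "0 < - laplacian mu w y"
    using w(1)[unfolded superharmonic_def, rule_format, of y] w(5) by simp
  then have c: "0 < c" unfolding c_def using vweight_pos[of y] by (rule mult_pos_pos)
  have "green mu x y \<le> ennreal (D / c * f x powr (p - 1))" for x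
  proof -
    have "green mu x y = ennreal (1 / c) * (ennreal c * green mu x y)"
      using c by (simp flip: mult.assoc ennreal_mult')
    also have "\<dots> \<le> ennreal (1 / c) * ennreal (w x)"
      unfolding c_def by (intro mult_left_mono green_le_superharmonic w) auto
    also have "\<dots> \<le> ennreal (1 / c) * ennreal (D * v x)"
      by (intro mult_left_mono ennreal_leI w) auto
    also have "\<dots> = ennreal (D / c * f x powr (p - 1))"
      using c by (simp add: v_def flip: ennreal_mult')
    finally show ?thesis .
  qed
  then have "Lq_norm mu (ennreal (p / (p - 1))) (\<lambda>x. green mu x y) < \<infinity>"
    using w(3) c by (intro green_Lq_of_green_op_finite[OF p f Gf[of y], of "D / c"]) auto
  then show ?thesis by blast
qed

text \<open>The solution is \<open>G(g\<^bsup>q-1\<^esup>)\<close>, whose value at \<open>y\<close> is \<open>\<integral> g\<^bsup>q\<^esup> d\<mu>\<close>.\<close>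

lemma nonharmonic_solution_of_green_Lq:
  assumes p: "1 < p" and fin: "Lq_norm mu (ennreal (p / (p - 1))) (\<lambda>x. green mu x y) < \<infinity>"
  shows "\<exists>u. (\<forall>x. 0 \<le> u x) \<and> solves_system mu p u \<and> laplacian mu u y \<noteq> 0"
proof -
  define r where "r = p / (p - 1)"
  have r: "1 < r" "(r - 1) * (p - 1) = 1" using p by (auto simp: r_def field_simps)
  define g where "g = (\<lambda>x. enn2real (green mu x y))"
  have gfin: "green mu x y < \<infinity>" for x using Lq_norm_finite_imp_finite[OF fin] .
  then have g: "green mu x y = ennreal (g x)" "0 \<le> g x" for x
    by (simp_all add: g_def)
  define f where "f = (\<lambda>x. g x powr (r - 1))"
  have "green_op mu f y = (\<integral>\<^sup>+ x. ennreal_powr (green mu x y) r * ennreal (vweight mu x) \<partial>count_space UNIV)"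
    unfolding green_op_def
    by (intro nn_integral_cong)
      (simp add: green_sym[of y] g f_def ennreal_powr_def powr_mult_base flip: ennreal_mult')
  also have "\<dots> < \<infinity>" using fin r by (simp only: Lq_norm_real r_def[symmetric])
  finally have Gf: "green_op mu f x < \<infinity>" for x by (rule green_op_finite)
  define u where "u = (\<lambda>x. enn2real (green_op mu f x))"
  have lap: "laplacian mu u x = - f x" for x
    unfolding u_def using Gf by (intro laplacian_green_op) (auto simp: f_def)
  \<comment> \<open>The exponents \<open>r - 1\<close> and \<open>p - 1\<close> cancel, so the
    second inequality is superharmonicity of the Green function.\<close>
  have "(\<lambda>x. (- laplacian mu u x) powr (p - 1)) = g"
    using r g by (simp add: lap f_def powr_powr fun_eq_iff)
  moreover have "superharmonic mu g" unfolding g_def using gfin by (rule superharmonic_green)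
  moreover have "superharmonic mu u" by (simp add: superharmonic_def lap f_def)
  ultimately have "solves_system mu p u" using p by (simp add: solves_system_iff)
  \<comment> \<open>If \<open>g y\<close> were 0, the Laplacian of \<open>g\<close> at
    \<open>y\<close> would be an average of non-negative values, whereas at the pole it is
    negative.\<close>
  moreover have "g y \<noteq> 0"
  proof
    assume "g y = 0"
    then have "g x \<ge> g y" for x using g by simp
    moreover have "laplacian mu g y < 0"
      using vweight_pos[of y] unfolding g_def by (simp add: laplacian_green[OF gfin])
    ultimately show False
      using sum_nonneg[of "{x. adj mu y x}" "\<lambda>x. trans_prob mu y x * g x"] g
      by (simp add: laplacian_eq \<open>g y = 0\<close> trans_prob_nonneg)
  qed
  ultimately show ?thesis
    using lap[of y] by (intro exI[of _ u]) (simp add: f_def u_def)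
qed

section \<open>Parabolicity and the system, for \<open>p > 1\<close> and for
  \<open>p = 1\<close>\<close>

lemma Lp_parabolic_iff_system:
  assumes "1 < p"
  shows "Lp_parabolic mu p (ennreal (p / (p - 1))) \<longleftrightarrow>
    (\<forall>u. (\<forall>x. 0 \<le> u x) \<and> solves_system mu p u \<longrightarrow> (\<forall>x. laplacian mu u x = 0))"
proof -
  have "0 < ennreal (p / (p - 1))" using assms by simp
  then have "\<not> Lp_parabolic mu p (ennreal (p / (p - 1))) \<longleftrightarrow>
      (\<exists>y. Lq_norm mu (ennreal (p / (p - 1))) (\<lambda>x. green mu x y) < \<infinity>)"
    by (simp add: Lp_parabolic_iff_green less_top)
  also have "\<dots> \<longleftrightarrow> (\<exists>u. (\<forall>x. 0 \<le> u x) \<and> solves_system mu p u \<and> (\<exists>x. laplacian mu u x \<noteq> 0))"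
    using green_Lq_of_nonharmonic_solution[OF assms] nonharmonic_solution_of_green_Lq[OF assms] by blast
  finally show ?thesis by blast
qed

text \<open>For \<open>p = 1\<close> the system only says that \<open>u\<close> is superharmonic.
  Truncations are bounded, hence have finite sup norm, so any non-harmonic \<open>u \<ge> 0\<close>
  yields a bounded Green function.\<close>

lemma L1_parabolic_iff_system:
  "Lp_parabolic mu 1 \<infinity> \<longleftrightarrow>
    (\<forall>u. (\<forall>x. 0 \<le> u x) \<and> solves_system mu 1 u \<longrightarrow> (\<forall>x. laplacian mu u x = 0))"
proof -
  have "\<not> Lp_parabolic mu 1 \<infinity> \<longleftrightarrow> (\<exists>y. Lq_norm mu \<infinity> (\<lambda>x. green mu x y) < \<infinity>)"
    by (subst Lp_parabolic_iff_green) (simp_all add: less_top)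
  also have "\<dots> \<longleftrightarrow> (\<exists>u. (\<forall>x. 0 \<le> u x) \<and> superharmonic mu u \<and> (\<exists>x. laplacian mu u x \<noteq> 0))"
  proof safe
    fix y
    assume "Lq_norm mu \<infinity> (\<lambda>x. green mu x y) < \<infinity>"
    then have fin: "green mu x y < \<infinity>" for x by (rule Lq_norm_finite_imp_finite)
    show "\<exists>u. (\<forall>x. 0 \<le> u x) \<and> superharmonic mu u \<and> (\<exists>x. laplacian mu u x \<noteq> 0)"
      using superharmonic_green[OF fin] laplacian_green[OF fin, of y] vweight_pos[of y]
      by (intro exI[of _ "\<lambda>x. enn2real (green mu x y)"] conjI exI[of _ y]) auto
  next
    fix u a
    assume u: "\<forall>x. 0 \<le> u x" "superharmonic mu u" "laplacian mu u a \<noteq> 0"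
    have "\<nexists>c. \<forall>x. u x = c" using u(3) by (rule nonharmonic_imp_nonconstant)
    with u(1) obtain c y where c: "0 \<le> c" "laplacian mu (\<lambda>x. min (u x) c) y \<noteq> 0"
      using nonconstant_superharmonic_truncation[of u] by blast
    have "Lq_norm mu \<infinity> (\<lambda>x. ennreal (min (u x) c)) \<le> ennreal c"
      by (auto simp: Lq_norm_def intro!: SUP_least ennreal_leI)
    then have "Lq_norm mu \<infinity> (\<lambda>x. ennreal (min (u x) c)) < \<infinity>"
      by (rule le_less_trans) simp
    then have "Lq_norm mu \<infinity> (\<lambda>x. green mu x y) < \<infinity>"
      using c u(1) by (intro Lq_norm_green_finite[OF _ _ superharmonic_min_const[OF u(2)]]) auto
    then show "\<exists>y. Lq_norm mu \<infinity> (\<lambda>x. green mu x y) < \<infinity>" by blast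
  qed
  finally show ?thesis by (auto simp: solves_system_def)
qed

end

theorem theorem1p4:
  fixes mu :: "'v \<Rightarrow> 'v \<Rightarrow> real" and p :: real and q :: ennreal
  assumes "weighted_graph mu"
    and "1 \<le> p"
    and "1 / ennreal p + 1 / q = 1"
  shows "(Lp_parabolic mu p q \<longleftrightarrow>
            (\<forall>u. (\<forall>x. 0 \<le> u x) \<and> solves_system mu p u \<longrightarrow> (\<forall>x. laplacian mu u x = 0)))
       \<and> (Lp_parabolic mu p q \<longleftrightarrow> Lq_Liouville_const mu q)
       \<and> ((\<lambda>_. 1) \<notin> Lq_plus mu q \<longrightarrow> (Lp_parabolic mu p q \<longleftrightarrow> Lq_Liouville mu q))"
proof -
  interpret weighted_graph mu by fact
  have "0 < q"
    using assms(2,3) by (cases rule: conjugate_exponent_cases) auto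
  moreover have "Lp_parabolic mu p q \<longleftrightarrow>
      (\<forall>u. (\<forall>x. 0 \<le> u x) \<and> solves_system mu p u \<longrightarrow> (\<forall>x. laplacian mu u x = 0))"
    using assms(2,3)
  proof (cases rule: conjugate_exponent_cases)
    case 1
    then show ?thesis using L1_parabolic_iff_system by simp
  next
    case 2
    then show ?thesis using Lp_parabolic_iff_system by simp
  qed
  ultimately show ?thesis
    using Lp_parabolic_iff_Liouville_const Liouville_const_iff_Liouville by blast
qed

end
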